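(* Let $\mathbf{H}=(H,\bar\circ,{}^{-1},1_H)$ be an $\ell$-group, $\mathbf{J}$ a chain, $\mathbf{F}=(F,\wedge,\vee,\circledcirc,{}^\ell,{}^r,1_F)$ an $\ell$-pregroup, and $*$ a left action of the group $H$ on the set $J$ that is monotone in both coordinates. Then the wreath product $\mathbf{H}\wr_{\mathbf{J},*}\mathbf{F}$ (defined below) is an $\ell$-pregroup. Moreover: (1) for every positive integer $k$, $\mathbf{H}\wr_{\mathbf{J},*}\mathbf{F}$ is $k$-periodic iff $\mathbf{F}$ is $k$-periodic; (2) $\mathbf{H}\wr_{\mathbf{J},*}\mathbf{F}$ is distributive iff $\mathbf{F}$ is distributive.
   Context: An $\ell$-pregroup is an algebra $(A,\wedge,\vee,\cdot,{}^{\ell},{}^{r},1)$ with lattice reduct, monoid reduct, order-preserving multiplication, and $x^{\ell}x\le 1\le xx^{\ell}$, $xx^{r}\le 1\le x^{r}x$; an $\ell$-group is an $\ell$-pregroup with $x^\ell=x^r=x^{-1}$. It is $k$-periodic if it satisfies $x^{\ell^k}=x^{r^k}$, and distributive if its lattice is distributive. The wreath product $\mathbf{H}\wr_{\mathbf{J},*}\mathbf{F}$ has universe $H\times F^J$. For $n,n_1,n_2\in F^J$ and $h\in H$ set $(n_1\odot n_2)(j)=n_1(j)\circledcirc n_2(j)$, $(n\otimes h)(j)=n(h*j)$, and $n^\ell(j)=n(j)^\ell$, $n^r(j)=n(j)^r$. Operations: $(h_1,n_1)(h_2,n_2)=(h_1\bar\circ h_2,(n_1\otimes h_2)\odot n_2)$,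 unit $(1_H,1_N)$ where $1_N(j)=1_F$; $(h,n)^\ell=(h^{-1},n^\ell\otimes h^{-1})$, $(h,n)^r=(h^{-1},n^r\otimes h^{-1})$; order $(h_1,n_1)\le(h_2,n_2)$ iff $h_1\le h_2$ and, for all $j$, $h_1*j=h_2*j$ implies $n_1(j)\le n_2(j)$; $(h_1,n_1)\vee(h_2,n_2)=(h_1\vee h_2,n_\vee)$ and $(h_1,n_1)\wedge(h_2,n_2)=(h_1\wedge h_2,n_\wedge)$, where $n_\vee(j)=n_2(j)$, $n_1(j)$, $n_1(j)\vee n_2(j)$ and $n_\wedge(j)=n_1(j)$, $n_2(j)$, $n_1(j)\wedge n_2(j)$ according as $h_1*j<h_2*j$, $h_2*j<h_1*j$, $h_1*j=h_2*j$ respectively.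
   Formalization: The action is additionally assumed to send joins in H to pointwise maxima: (g∨h)*j = max(g*j, h*j). With order preservation alone the claim fails, e.g. ℤ×ℤ acting on ℤ by (a,b)*j = a+b+j with F = ℤ. The chain J is taken to be nonempty. *)

theory Defs
  imports Main
begin

text \<open>
  The universe of an algebra is the whole type. The field \<open>le\<close> carries the lattice order; it is
  tied to \<open>meet\<close> and \<open>join\<close> by \<open>class.lattice\<close> below.
\<close>

record 'a lp_alg =
  le   :: "'a \<Rightarrow> 'a \<Rightarrow> bool"
  meet :: "'a \<Rightarrow> 'a \<Rightarrow> 'a"
  join :: "'a \<Rightarrow> 'a \<Rightarrow> 'a"
  mult :: "'a \<Rightarrow> 'a \<Rightarrow> 'a"
  linv :: "'a \<Rightarrow> 'a"
  rinv :: "'a \<Rightarrow> 'a"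
  unit :: "'a"

definition lt :: "'a lp_alg \<Rightarrow> 'a \<Rightarrow> 'a \<Rightarrow> bool" where
  "lt A x y \<longleftrightarrow> le A x y \<and> \<not> le A y x"

definition lpregroup :: "'a lp_alg \<Rightarrow> bool" where
  "lpregroup A \<longleftrightarrow>
     class.lattice (meet A) (le A) (lt A) (join A) \<and>
     monoid (mult A) (unit A) \<and>
     (\<forall>x y z. le A x y \<longrightarrow> le A (mult A x z) (mult A y z) \<and> le A (mult A z x) (mult A z y)) \<and>
     (\<forall>x. le A (mult A (linv A x) x) (unit A) \<and> le A (unit A) (mult A x (linv A x))) \<and>
     (\<forall>x. le A (mult A x (rinv A x)) (unit A) \<and> le A (unit A) (mult A (rinv A x) x))"

definition lgroup :: "'a lp_alg \<Rightarrow> bool" where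
  "lgroup A \<longleftrightarrow> lpregroup A \<and> rinv A = linv A \<and> group (mult A) (unit A) (linv A)"

definition periodic :: "nat \<Rightarrow> 'a lp_alg \<Rightarrow> bool" where
  "periodic k A \<longleftrightarrow> (\<forall>x. (linv A ^^ k) x = (rinv A ^^ k) x)"

definition distributive :: "'a lp_alg \<Rightarrow> bool" where
  "distributive A \<longleftrightarrow> class.distrib_lattice (meet A) (le A) (lt A) (join A)"

definition left_action :: "'h lp_alg \<Rightarrow> ('h \<Rightarrow> 'j \<Rightarrow> 'j) \<Rightarrow> bool" where
  "left_action H act \<longleftrightarrow>
     (\<forall>j. act (unit H) j = j) \<and> (\<forall>g h j. act (mult H g h) j = act g (act h j))"

definition monotone_action :: "'h lp_alg \<Rightarrow> ('h \<Rightarrow> 'j::linorder \<Rightarrow> 'j) \<Rightarrow> bool" where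
  "monotone_action H act \<longleftrightarrow>
     (\<forall>g h j. le H g h \<longrightarrow> act g j \<le> act h j) \<and> (\<forall>h. mono (act h))"

text \<open>
  Monotonicity in the first coordinate has to be understood in the lattice sense, i.e. joins in \<open>H\<close>
  act as pointwise maxima (preservation of meets follows by taking inverses). Mere
  order preservation does not suffice for the wreath product to be a lattice: let
  \<open>\<int> \<times> \<int>\<close> (componentwise order) act on \<open>\<int>\<close> by \<open>(a, b) * j = a + b + j\<close>. Then
  \<open>((1, 0) \<or> (0, 1)) * j = j + 2\<close>, and for nontrivial \<open>F\<close> the operation \<open>\<or>\<close> of the wreath product is
  not associative: with \<open>x = ((1, 0), n\<^sub>1)\<close>, \<open>y = ((0, 1), n\<^sub>2)\<close>, \<open>z = ((1, 1), n\<^sub>3)\<close> one gets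
  \<open>(x \<or> y) \<or> z = ((1, 1), n\<^sub>1 \<or> n\<^sub>2 \<or> n\<^sub>3)\<close> but \<open>x \<or> (y \<or> z) = ((1, 1), n\<^sub>3)\<close>.
\<close>

definition join_preserving_action :: "'h lp_alg \<Rightarrow> ('h \<Rightarrow> 'j::linorder \<Rightarrow> 'j) \<Rightarrow> bool" where
  "join_preserving_action H act \<longleftrightarrow>
     (\<forall>g h j. act (join H g h) j = max (act g j) (act h j))"

definition odot :: "'f lp_alg \<Rightarrow> ('j \<Rightarrow> 'f) \<Rightarrow> ('j \<Rightarrow> 'f) \<Rightarrow> 'j \<Rightarrow> 'f" where
  "odot F n1 n2 = (\<lambda>j. mult F (n1 j) (n2 j))"

definition otimes :: "('h \<Rightarrow> 'j \<Rightarrow> 'j) \<Rightarrow> ('j \<Rightarrow> 'f) \<Rightarrow> 'h \<Rightarrow> 'j \<Rightarrow> 'f" where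
  "otimes act n h = (\<lambda>j. n (act h j))"

text \<open>In \<open>H\<close>, the field \<open>linv\<close> is the group inverse.\<close>

definition wreath ::
  "'h lp_alg \<Rightarrow> ('h \<Rightarrow> 'j::linorder \<Rightarrow> 'j) \<Rightarrow> 'f lp_alg \<Rightarrow> ('h \<times> ('j \<Rightarrow> 'f)) lp_alg" where
  "wreath H act F = \<lparr>
     le = (\<lambda>(h1, n1) (h2, n2). le H h1 h2 \<and> (\<forall>j. act h1 j = act h2 j \<longrightarrow> le F (n1 j) (n2 j))),
     meet = (\<lambda>(h1, n1) (h2, n2). (meet H h1 h2,
       \<lambda>j. if act h1 j < act h2 j then n1 j
           else if act h2 j < act h1 j then n2 j
           else meet F (n1 j) (n2 j))),
     join = (\<lambda>(h1, n1) (h2, n2). (join H h1 h2,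
       \<lambda>j. if act h1 j < act h2 j then n2 j
           else if act h2 j < act h1 j then n1 j
           else join F (n1 j) (n2 j))),
     mult = (\<lambda>(h1, n1) (h2, n2). (mult H h1 h2, odot F (otimes act n1 h2) n2)),
     linv = (\<lambda>(h, n). (linv H h, otimes act (\<lambda>j. linv F (n j)) (linv H h))),
     rinv = (\<lambda>(h, n). (linv H h, otimes act (\<lambda>j. rinv F (n j)) (linv H h))),
     unit = (unit H, \<lambda>j. unit F) \<rparr>"

end

theory Submission
  imports Defs
begin

text \<open>
  Everything is checked pointwise. Since \<open>J\<close> is a chain and joins (hence, by inversion, meets) of
  \<open>H\<close> act as pointwise maxima (minima), the second coordinate of a join or meet is governed at each
  point by the comparison of the images of that point. The algebra \<open>F\<close> embeds in the
  wreath product by constant functions over the unit of \<open>H\<close>, which reflects periodicity and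
  distributivity. Conversely, the iterated left and right inverses in the wreath product differ only
  in the iterated inverse of \<open>F\<close> that is applied, and \<open>H\<close> itself is always distributive, being an
  \<open>\<ell>\<close>-group.
\<close>

lemma distributiveI:
  assumes "class.lattice (meet A) (le A) (lt A) (join A)"
    and "\<And>x y z. join A x (meet A y z) = meet A (join A x y) (join A x z)"
  shows "distributive A"
  unfolding distributive_def class.distrib_lattice_def class.distrib_lattice_axioms_def
  using assms by blast

lemma distributiveD:
  assumes "distributive A"
  shows "join A x (meet A y z) = meet A (join A x y) (join A x z)"
  using assms
  unfolding distributive_def class.distrib_lattice_def class.distrib_lattice_axioms_def
  by blast

locale lpregroup_alg =
  fixes A :: "'a lp_alg"
  assumes lpregroup: "lpregroup A"
begin

sublocale lattice "meet A" "le A" "lt A" "join A"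
  using lpregroup by (simp add: lpregroup_def)

sublocale monoid "mult A" "unit A"
  using lpregroup by (simp add: lpregroup_def)

lemma mult_right_mono: "le A x y \<Longrightarrow> le A (mult A x z) (mult A y z)"
  and mult_left_mono: "le A x y \<Longrightarrow> le A (mult A z x) (mult A z y)"
  and linv_mult_le: "le A (mult A (linv A x) x) (unit A)"
  and mult_linv_ge: "le A (unit A) (mult A x (linv A x))"
  and mult_rinv_le: "le A (mult A x (rinv A x)) (unit A)"
  and rinv_mult_ge: "le A (unit A) (mult A (rinv A x) x)"
  using lpregroup by (simp_all add: lpregroup_def)

end

locale lgroup_alg =
  fixes A :: "'a lp_alg"
  assumes lgroup: "lgroup A"
begin

sublocale lpregroup_alg A
  by unfold_locales (use lgroup in \<open>simp add: lgroup_def\<close>)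

sublocale group "mult A" "unit A" "linv A"
  using lgroup by (simp add: lgroup_def)

lemma linv_antimono:
  assumes "le A x y"
  shows "le A (linv A y) (linv A x)"
proof -
  have "le A (mult A (linv A x) (mult A x (linv A y)))
      (mult A (linv A x) (mult A y (linv A y)))"
    using assms by (intro mult_left_mono mult_right_mono)
  then show ?thesis by (simp add: assoc[symmetric])
qed

text \<open>Inversion is an antitone involution, so it exchanges meets and joins. This lets
  \<open>act_meet\<close> be deduced from the assumption on joins alone.\<close>

lemma linv_meet: "linv A (meet A x y) = join A (linv A x) (linv A y)"
proof (rule order.antisym)
  let ?m = "linv A (join A (linv A x) (linv A y))"
  have "le A ?m x" "le A ?m y"
    using linv_antimono[of "linv A x"] linv_antimono[of "linv A y"] by fastforce+
  then have "le A ?m (meet A x y)" by simp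
  then show "le A (linv A (meet A x y)) (join A (linv A x) (linv A y))"
    using linv_antimono by fastforce
qed (simp add: linv_antimono)

text \<open>
  With \<open>b = y \<squnion> z\<close> and \<open>d = x \<sqinter> b\<close>, each \<open>c \<in> {y, z}\<close> satisfies \<open>d b\<inverse> c \<le> x \<sqinter> c\<close>. So any
  upper bound \<open>u\<close> of \<open>x \<sqinter> y\<close> and \<open>x \<sqinter> z\<close> satisfies \<open>c \<le> b d\<inverse> u\<close>, hence \<open>b \<le> b d\<inverse> u\<close> and \<open>d \<le> u\<close>.
\<close>
lemma meet_join_le:
  "le A (meet A x (join A y z)) (join A (meet A x y) (meet A x z))"
proof -
  define b where "b = join A y z"
  define d where "d = meet A x b"
  define u where "u = join A (meet A x y) (meet A x z)"
  have bound: "le A c (mult A b (mult A (linv A d) u))"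
    if c: "le A c b" "le A (meet A x c) u" for c
  proof -
    let ?e = "mult A d (mult A (linv A b) c)"
    have "le A (mult A (linv A b) c) (unit A)"
      using mult_left_mono[OF c(1), of "linv A b"] by simp
    then have "le A ?e d"
      using mult_left_mono by fastforce
    then have "le A ?e x" by (simp add: d_def)
    moreover have "le A d b" by (simp add: d_def)
    then have "le A ?e c"
      using mult_right_mono[of d b "mult A (linv A b) c"] by (simp add: assoc[symmetric])
    ultimately have "le A ?e u"
      using c(2) by (meson inf_greatest order.trans)
    then have "le A (mult A b (mult A (linv A d) ?e)) (mult A b (mult A (linv A d) u))"
      by (intro mult_left_mono)
    moreover have "mult A b (mult A (linv A d) ?e) = c"
      by (metis assoc left_inverse left_neutral right_inverse)
    ultimately show ?thesis by simp
  qed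
  have "le A y (mult A b (mult A (linv A d) u))" "le A z (mult A b (mult A (linv A d) u))"
    by (rule bound; simp add: b_def u_def)+
  then have "le A b (mult A b (mult A (linv A d) u))"
    by (simp add: b_def)
  then have "le A (mult A d (mult A (linv A b) b))
      (mult A d (mult A (linv A b) (mult A b (mult A (linv A d) u))))"
    by (intro mult_left_mono)
  moreover have "mult A d (mult A (linv A b) (mult A b (mult A (linv A d) u))) = u"
    by (metis assoc left_inverse left_neutral right_inverse)
  ultimately have "le A d u" by simp
  then show ?thesis by (simp add: b_def d_def u_def)
qed

lemma distributive: "distributive A"
proof (rule distributiveI)
  show "class.lattice (meet A) (le A) (lt A) (join A)" by unfold_locales
  \<comment> \<open>One inequality holds in every lattice; in any lattice this law also yields its
    dual, the form needed here.\<close>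
  have "meet A x (join A y z) = join A (meet A x y) (meet A x z)" for x y z
    by (rule order.antisym[OF meet_join_le distrib_inf_le])
  then show "join A x (meet A y z) = meet A (join A x y) (join A x z)" for x y z
    by (rule distrib_imp1)
qed

end

locale wreath_product = H: lgroup_alg H + F: lpregroup_alg F
  for H :: "'h lp_alg" and F :: "'f lp_alg" +
  fixes act :: "'h \<Rightarrow> 'j::linorder \<Rightarrow> 'j"
  assumes action: "left_action H act"
    and monotone: "monotone_action H act"
    and join_preserving: "join_preserving_action H act"
begin

abbreviation "W \<equiv> wreath H act F"

lemma act_unit [simp]: "act (unit H) j = j"
  and act_mult [simp]: "act (mult H g h) j = act g (act h j)"
  using action by (simp_all add: left_action_def)

lemma act_linv [simp]: "act (linv H h) (act h j) = j" "act h (act (linv H h) j) = j"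
  by (simp_all flip: act_mult)

lemma act_inject [simp]: "act h i = act h j \<longleftrightarrow> i = j"
  by (metis act_linv(1))

lemma act_le: "le H g h \<Longrightarrow> act g j \<le> act h j"
  using monotone by (simp add: monotone_action_def)

lemma act_join [simp]: "act (join H g h) j = max (act g j) (act h j)"
  using join_preserving by (simp add: join_preserving_action_def)

text \<open>Join preservation for the two inverses, applied at the image \<open>x\<close> of
  \<open>j\<close> under the meet, recovers \<open>j\<close> as the maximum of the two preimages of
  \<open>x\<close>. One preimage is therefore \<open>j\<close> itself, so \<open>g\<close> or
  \<open>h\<close> sends \<open>j\<close> to \<open>x\<close>, and by monotonicity \<open>x\<close>
  lies below both images.\<close>

lemma act_meet [simp]: "act (meet H g h) j = min (act g j) (act h j)"
proof -
  define x where "x = act (meet H g h) j"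
  have j: "j = max (act (linv H g) x) (act (linv H h) x)"
    by (simp flip: act_join H.linv_meet add: x_def)
  have "act g j = x \<or> act h j = x"
    using j by (metis act_linv(2) max_def)
  moreover have "x \<le> act g j" "x \<le> act h j"
    by (simp_all add: x_def act_le)
  ultimately show ?thesis
    unfolding x_def[symmetric] by (auto simp: min_def)
qed

lemma le_W [simp]: "le W (g, m) (h, n) \<longleftrightarrow>
    le H g h \<and> (\<forall>j. act g j = act h j \<longrightarrow> le F (m j) (n j))"
  and meet_W [simp]: "meet W (g, m) (h, n) = (meet H g h, \<lambda>j.
    if act g j < act h j then m j else if act h j < act g j then n j else meet F (m j) (n j))"
  and join_W [simp]: "join W (g, m) (h, n) = (join H g h, \<lambda>j.
    if act g j < act h j then n j else if act h j < act g j then m j else join F (m j) (n j))"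
  and mult_W [simp]: "mult W (g, m) (h, n) = (mult H g h, \<lambda>j. mult F (m (act h j)) (n j))"
  and linv_W [simp]: "linv W (h, n) = (linv H h, \<lambda>j. linv F (n (act (linv H h) j)))"
  and rinv_W [simp]: "rinv W (h, n) = (linv H h, \<lambda>j. rinv F (n (act (linv H h) j)))"
  and unit_W [simp]: "unit W = (unit H, \<lambda>j. unit F)"
  by (simp_all add: wreath_def odot_def otimes_def)

lemma lattice_W: "class.lattice (meet W) (le W) (lt W) (join W)"
proof
  fix x y z :: "'h \<times> ('j \<Rightarrow> 'f)"
  obtain a l b m c n where [simp]: "x = (a, l)" "y = (b, m)" "z = (c, n)"
    by (cases x, cases y, cases z)
  show "lt W x y \<longleftrightarrow> le W x y \<and> \<not> le W y x" by (simp add: lt_def)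
  show "le W x x" by simp
  show "le W x z" if "le W x y" "le W y z"
  proof -
    have le: "le H a b" "le H b c" using that by simp_all
    have "le F (l j) (n j)" if "act a j = act c j" for j
    proof -
      \<comment> \<open>The image under \<open>b\<close> is squeezed between two equal points of the
        chain.\<close>
      have "act a j = act b j" "act b j = act c j"
        using act_le[OF le(1), of j] act_le[OF le(2), of j] that by simp_all
      then show ?thesis
        using \<open>le W x y\<close> \<open>le W y z\<close> by (auto intro: F.order.trans[of _ "m j"])
    qed
    then show ?thesis
      using le by (auto intro: H.order.trans)
  qed
  show "x = y" if "le W x y" "le W y x"
  proof -
    have "a = b" using that by (simp add: H.order.antisym)
    then show ?thesis using that by (auto intro: F.order.antisym)
  qed
  show "le W (meet W x y) x" "le W (meet W x y) y"
    "le W x (join W x y)" "le W y (join W x y)"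
    \<comment> \<open>At \<open>j\<close> the meet or join has the minimal or maximal image, so the
      order condition constrains only the arguments attaining it, and these are the ones whose
      values are used.\<close>
    by (auto simp: min_def max_def split: if_splits)
  show "le W x (meet W y z)" if "le W x y" "le W x z"
    using that by (auto simp: min_def split: if_splits)
  show "le W (join W y z) x" if "le W y x" "le W z x"
    using that by (auto simp: max_def split: if_splits)
qed

lemma lpregroup_W: "lpregroup W"
  unfolding lpregroup_def
proof (intro conjI allI impI)
  show "class.lattice (meet W) (le W) (lt W) (join W)" by (rule lattice_W)
  show "monoid (mult W) (unit W)"
    by unfold_locales (auto simp: H.assoc F.assoc)
  fix x y z :: "'h \<times> ('j \<Rightarrow> 'f)"
  obtain a l b m c n where [simp]: "x = (a, l)" "y = (b, m)" "z = (c, n)"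
    by (cases x, cases y, cases z)
  \<comment> \<open>On the right, the hypothesis is used at \<open>act c j\<close>. On the left,
    injectivity of \<open>act c\<close> gives \<open>act a j = act b j\<close>, so \<open>n\<close>
    is evaluated at the same point on both sides.\<close>
  show "le W (mult W x z) (mult W y z)" "le W (mult W z x) (mult W z y)" if "le W x y"
    using that
    by (auto simp: H.mult_right_mono H.mult_left_mono F.mult_right_mono F.mult_left_mono)
  show "le W (mult W (linv W x) x) (unit W)" "le W (unit W) (mult W x (linv W x))"
    "le W (mult W x (rinv W x)) (unit W)" "le W (unit W) (mult W (rinv W x) x)"
    by (simp_all add: F.linv_mult_le F.mult_linv_ge F.mult_rinv_le F.rinv_mult_ge)
qed

text \<open>Both inverses change the group coordinate and the index in the same way. Only the
  sharing of \<open>g\<close> and \<open>p\<close> matters, so the reindexing \<open>p\<close> is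
  left unspecified.\<close>

lemma inverse_power_W:
  "\<exists>g p. (linv W ^^ k) (h, n) = (g, \<lambda>j. (linv F ^^ k) (n (p j))) \<and>
    (rinv W ^^ k) (h, n) = (g, \<lambda>j. (rinv F ^^ k) (n (p j)))"
proof (induction k)
  case 0
  show ?case by (auto intro: exI[of _ id])
next
  case (Suc k)
  then obtain g p where
    "(linv W ^^ k) (h, n) = (g, \<lambda>j. (linv F ^^ k) (n (p j)))"
    "(rinv W ^^ k) (h, n) = (g, \<lambda>j. (rinv F ^^ k) (n (p j)))"
    by blast
  then show ?case
    by (intro exI[of _ "linv H g"] exI[of _ "\<lambda>j. p (act (linv H g) j)"]) simp
qed

lemma periodic_W_iff: "periodic k W \<longleftrightarrow> periodic k F"
proof
  assume W: "periodic k W"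
  show "periodic k F"
    unfolding periodic_def
  proof
    fix f
    \<comment> \<open>For a constant function the reindexing disappears.\<close>
    obtain g where
      "(linv W ^^ k) (unit H, \<lambda>j. f) = (g, \<lambda>j :: 'j. (linv F ^^ k) f)"
      "(rinv W ^^ k) (unit H, \<lambda>j. f) = (g, \<lambda>j :: 'j. (rinv F ^^ k) f)"
      using inverse_power_W[of k "unit H" "\<lambda>j. f"] by blast
    then show "(linv F ^^ k) f = (rinv F ^^ k) f"
      using W unfolding periodic_def by (metis prod.inject)
  qed
next
  assume F: "periodic k F"
  show "periodic k W"
    unfolding periodic_def
  proof
    fix x :: "'h \<times> ('j \<Rightarrow> 'f)"
    obtain h n where x: "x = (h, n)" by (cases x)
    obtain g p where
      "(linv W ^^ k) x = (g, \<lambda>j. (linv F ^^ k) (n (p j)))"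
      "(rinv W ^^ k) x = (g, \<lambda>j. (rinv F ^^ k) (n (p j)))"
      using inverse_power_W[of k h n] unfolding x by blast
    then show "(linv W ^^ k) x = (rinv W ^^ k) x"
      using F by (simp add: periodic_def)
  qed
qed

lemma distributive_W_iff: "distributive W \<longleftrightarrow> distributive F"
proof
  assume W: "distributive W"
  show "distributive F"
  proof (rule distributiveI)
    show "class.lattice (meet F) (le F) (lt F) (join F)" by unfold_locales
    fix x y z
    show "join F x (meet F y z) = meet F (join F x y) (join F x z)"
      \<comment> \<open>With equal group coordinates all images tie, so only the operations of
        \<open>F\<close> remain.\<close>
      using distributiveD[OF W, of "(unit H, \<lambda>j. x)" "(unit H, \<lambda>j. y)" "(unit H, \<lambda>j. z)"]
      by (simp add: fun_eq_iff)
  qed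
next
  assume F: "distributive F"
  show "distributive W"
  proof (rule distributiveI[OF lattice_W])
    fix x y z :: "'h \<times> ('j \<Rightarrow> 'f)"
    obtain a l b m c n where [simp]: "x = (a, l)" "y = (b, m)" "z = (c, n)"
      by (cases x, cases y, cases z)
    have "snd (join W x (meet W y z)) j = snd (meet W (join W x y) (join W x z)) j" for j
      \<comment> \<open>Distributivity of \<open>F\<close> is needed where all three images agree.
        If \<open>act a j\<close> ties with one image above the other, absorption suffices, with
        \<open>F.inf_commute\<close> orienting it; the remaining cases are immediate.\<close>
      by (cases rule: linorder_cases[of "act a j" "act b j"];
          cases rule: linorder_cases[of "act a j" "act c j"];
          cases rule: linorder_cases[of "act b j" "act c j"];
          auto simp: distributiveD[OF F] F.inf_commute)
    moreover have "fst (join W x (meet W y z)) = fst (meet W (join W x y) (join W x z))"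
      using distributiveD[OF H.distributive, of a b c] by simp
    ultimately show "join W x (meet W y z) = meet W (join W x y) (join W x z)"
      by (intro prod_eqI ext)
  qed
qed

end

theorem theorem2p14:
  fixes H :: "'h lp_alg" and act :: "'h \<Rightarrow> 'j::linorder \<Rightarrow> 'j" and F :: "'f lp_alg"
  assumes "lgroup H" and "lpregroup F"
    and "left_action H act" and "monotone_action H act" and "join_preserving_action H act"
  shows "lpregroup (wreath H act F)
    \<and> (\<forall>k>0. periodic k (wreath H act F) \<longleftrightarrow> periodic k F)
    \<and> (distributive (wreath H act F) \<longleftrightarrow> distributive F)"
proof -
  interpret wreath_product H F act
    using assms by unfold_locales
  show ?thesis
    using lpregroup_W periodic_W_iff distributive_W_iff by blast
qed

end
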